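(* Let $A=[a_{i,j}]$ be a $3\times 3$ doubly stochastic matrix. Then $$\|A\|_{\mathrm{F}}^2 = \operatorname{maxtr}(A)$$ if and only if there are $3\times 3$ permutation matrices $P$ and $Q$ such that $PAQ$ is equal to one of the following six matrices: $$I_3=\begin{bmatrix}1&0&0\\0&1&0\\0&0&1\end{bmatrix},\qquad J_3=\begin{bmatrix}\frac13&\frac13&\frac13\\ \frac13&\frac13&\frac13\\ \frac13&\frac13&\frac13\end{bmatrix},\qquad I_1\oplus J_2=\begin{bmatrix}1&0&0\\0&\frac12&\frac12\\0&\frac12&\frac12\end{bmatrix},$$ $$S=\begin{bmatrix}0&\frac12&\frac12\\ \frac12&\frac14&\frac14\\ \frac12&\frac14&\frac14\end{bmatrix},\qquad T=\begin{bmatrix}0&\frac12&\frac12\\ \frac12&0&\frac12\\ \frac12&\frac12&0\end{bmatrix},\qquad R=\begin{bmatrix}\frac35&0&\frac25\\ 0&\frac35&\frac25\\ \frac25&\frac25&\frac15\end{bmatrix}.$$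
   Context: A real $n\times n$ matrix $A=[a_{i,j}]$ is doubly stochastic if $a_{i,j}\ge 0$ for all $i,j$ and every row sum and every column sum of $A$ equals $1$. The squared Frobenius norm is $\|A\|_{\mathrm{F}}^2=\sum_{i=1}^n\sum_{j=1}^n a_{i,j}^2$. The maximal trace of $A$ is $\operatorname{maxtr}(A)=\max_{\sigma\in S_n}\sum_{i=1}^n a_{i,\sigma(i)}$, where $S_n$ is the group of permutations of $\{1,\dots,n\}$. *)

theory Defs
  imports "HOL-Analysis.Analysis"
begin

definition doubly_stochastic :: "real ^ 'n ^ 'n \<Rightarrow> bool" where
  "doubly_stochastic A \<longleftrightarrow>
     (\<forall>i j. A $ i $ j \<ge> 0) \<and>
     (\<forall>i. (\<Sum>j\<in>UNIV. A $ i $ j) = 1) \<and>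
     (\<forall>j. (\<Sum>i\<in>UNIV. A $ i $ j) = 1)"

definition frobenius_sq :: "real ^ 'n ^ 'n \<Rightarrow> real" where
  "frobenius_sq A = (\<Sum>i\<in>UNIV. \<Sum>j\<in>UNIV. (A $ i $ j)\<^sup>2)"

lemma frobenius_sq_eq_norm: "frobenius_sq A = (norm A)\<^sup>2"
  by (simp add: frobenius_sq_def norm_vec_def L2_set_def sum_nonneg)

definition maxtr :: "real ^ 'n ^ 'n \<Rightarrow> real" where
  "maxtr A = Max ((\<lambda>\<sigma>. \<Sum>i\<in>UNIV. A $ i $ \<sigma> i) ` {\<sigma>. \<sigma> permutes (UNIV :: 'n set)})"

definition permutation_matrix :: "real ^ 'n ^ 'n \<Rightarrow> bool" where
  "permutation_matrix P \<longleftrightarrow>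
     (\<exists>\<sigma>. \<sigma> permutes (UNIV :: 'n set) \<and> P = (\<chi> i j. if j = \<sigma> i then 1 else 0))"

(* vector lists the entries (rows, here) at the indices 1, 2, 3 of the type 3, where 3 = 0. *)

definition mat_J3 :: "real ^ 3 ^ 3" where
  "mat_J3 = vector [vector [1/3, 1/3, 1/3],
                    vector [1/3, 1/3, 1/3],
                    vector [1/3, 1/3, 1/3]]"

definition mat_I1J2 :: "real ^ 3 ^ 3" where
  "mat_I1J2 = vector [vector [1, 0, 0],
                      vector [0, 1/2, 1/2],
                      vector [0, 1/2, 1/2]]"

definition mat_S :: "real ^ 3 ^ 3" where
  "mat_S = vector [vector [0, 1/2, 1/2],
                   vector [1/2, 1/4, 1/4],
                   vector [1/2, 1/4, 1/4]]"

definition mat_T :: "real ^ 3 ^ 3" where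
  "mat_T = vector [vector [0, 1/2, 1/2],
                   vector [1/2, 0, 1/2],
                   vector [1/2, 1/2, 0]]"

definition mat_R :: "real ^ 3 ^ 3" where
  "mat_R = vector [vector [3/5, 0, 2/5],
                   vector [0, 3/5, 2/5],
                   vector [2/5, 2/5, 1/5]]"

end

(* A convex decomposition of A into permutation matrices writes the squared norm as the weighted
   average of the traces of A along these permutations, so equality holds iff every permutation of
   positive weight has maximal trace. For n = 3 each cell lies on exactly one even and one odd
   permutation, so the trace along a permutation is 3 times its weight plus the total weight of the
   opposite parity. Equality therefore makes the nonzero even weights equal to one number u and the
   nonzero odd weights equal to one number v, and u, v follow from the two support sizes. *)
theory Submission
  imports Defs
begin

section \<open>Residues mod 3 as matrix indices, and their permutations\<close>

lemma Z3_simps: "(3::3) = 0" "(4::3) = 1" "(5::3) = 2" "(6::3) = 0" "- (1::3) = 2" "- (2::3) = 1"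
  by simp_all

lemma Z3_cases: "i = 0 \<or> i = 1 \<or> i = (2::3)"
  using exhaust_3[of i] by (auto simp: Z3_simps)

lemma Z3_all: "(\<forall>i::3. P i) \<longleftrightarrow> P 0 \<and> P 1 \<and> P 2"
  by (metis Z3_cases)

lemma Z3_ex: "(\<exists>i::3. P i) \<longleftrightarrow> P 0 \<or> P 1 \<or> P 2"
  by (metis Z3_cases)

lemma Z3_UNIV: "(UNIV :: 3 set) = {0, 1, 2}"
  using Z3_cases by auto

lemma Z3_sum: "(\<Sum>i\<in>(UNIV :: 3 set). f i) = f 0 + f 1 + f 2"
  by (simp add: sum_3 Z3_simps ac_simps)

lemma Z3_range: "range f = {f 0, f 1, f (2::3)}"
  by (simp add: Z3_UNIV)

lemma vector_3_nth_0: "(vector [a, b, c] :: 'a::zero ^ 3) $ 0 = c"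
  using vector_3(3)[of a b c] by (simp add: Z3_simps)

text \<open>The differences \<open>\<sigma> 1 - \<sigma> 0\<close> and
  \<open>\<sigma> 2 - \<sigma> 0\<close> are distinct nonzero residues, hence \<open>1, 2\<close> or
  \<open>2, 1\<close>. The first order gives the rotations (even), the second the reflections
  (odd).\<close>

lemma Z3_permutes:
  assumes "\<sigma> permutes (UNIV :: 3 set)"
  shows "(\<exists>c. \<sigma> = (\<lambda>i. i + c)) \<or> (\<exists>c. \<sigma> = (\<lambda>i. c - i))"
proof -
  have "inj \<sigma>"
    using assms by (rule permutes_inj)
  then have ne: "\<sigma> 1 - \<sigma> 0 \<noteq> 0" "\<sigma> 2 - \<sigma> 0 \<noteq> 0" "\<sigma> 1 - \<sigma> 0 \<noteq> \<sigma> 2 - \<sigma> 0"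
    by (simp_all add: inj_eq)
  then consider "\<sigma> 1 - \<sigma> 0 = 1" "\<sigma> 2 - \<sigma> 0 = 2" | "\<sigma> 1 - \<sigma> 0 = 2" "\<sigma> 2 - \<sigma> 0 = 1"
    using Z3_cases[of "\<sigma> 1 - \<sigma> 0"] Z3_cases[of "\<sigma> 2 - \<sigma> 0"] by metis
  then show ?thesis
  proof cases
    case 1
    then have "\<forall>i. \<sigma> i = i + \<sigma> 0"
      unfolding Z3_all by (simp add: diff_eq_eq)
    then show ?thesis
      by blast
  next
    case 2
    moreover have "\<sigma> 0 - 1 = 2 + \<sigma> 0" "\<sigma> 0 - 2 = 1 + \<sigma> 0"
      by (simp_all add: diff_eq_eq add.assoc add.left_commute Z3_simps)
    ultimately have "\<forall>i. \<sigma> i = \<sigma> 0 - i"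
      unfolding Z3_all by (simp add: diff_eq_eq)
    then show ?thesis
      by blast
  qed
qed

lemma permutes_add: "(\<lambda>i. i + c) permutes (UNIV :: 'a::group_add set)"
  by (rule bij_imp_permutes) (auto intro!: bij_betw_byWitness[where f' = "\<lambda>i. i - c"])

lemma permutes_minus: "(\<lambda>i. c - i) permutes (UNIV :: 'a::ab_group_add set)"
  by (rule bij_imp_permutes) (auto intro!: bij_betw_byWitness[where f' = "\<lambda>i. c - i"])

section \<open>Equivalence under row and column permutations, and its invariants\<close>

definition perm_equiv :: "real ^ 'n ^ 'n \<Rightarrow> real ^ 'n ^ 'n \<Rightarrow> bool" where
  "perm_equiv A B \<longleftrightarrow> (\<exists>\<sigma> \<tau>. \<sigma> permutes UNIV \<and> \<tau> permutes UNIV \<and> B = (\<chi> i j. A $ \<sigma> i $ \<tau> j))"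

lemma perm_equivI:
  assumes "\<sigma> permutes UNIV" "\<tau> permutes UNIV" "\<And>i j. B $ i $ j = A $ \<sigma> i $ \<tau> j"
  shows "perm_equiv A B"
  unfolding perm_equiv_def using assms by (intro exI[of _ \<sigma>] exI[of _ \<tau>]) (simp add: vec_eq_iff)

lemma perm_equiv_refl: "perm_equiv A A"
  by (rule perm_equivI[OF permutes_id permutes_id]) simp

lemma perm_equiv_sym:
  assumes "perm_equiv A B"
  shows "perm_equiv B A"
proof -
  obtain \<sigma> \<tau> where \<sigma>: "\<sigma> permutes UNIV" and \<tau>: "\<tau> permutes UNIV" and B: "B = (\<chi> i j. A $ \<sigma> i $ \<tau> j)"
    using assms unfolding perm_equiv_def by blast
  show ?thesis
    by (rule perm_equivI[OF permutes_inv[OF \<sigma>] permutes_inv[OF \<tau>]])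
      (simp add: B permutes_inverses[OF \<sigma>] permutes_inverses[OF \<tau>])
qed

lemma perm_equiv_trans:
  assumes "perm_equiv A B" "perm_equiv B C"
  shows "perm_equiv A C"
proof -
  obtain \<sigma> \<tau> where 1: "\<sigma> permutes UNIV" "\<tau> permutes UNIV" and B: "B = (\<chi> i j. A $ \<sigma> i $ \<tau> j)"
    using assms(1) unfolding perm_equiv_def by blast
  obtain \<sigma>' \<tau>' where 2: "\<sigma>' permutes UNIV" "\<tau>' permutes UNIV" and C: "C = (\<chi> i j. B $ \<sigma>' i $ \<tau>' j)"
    using assms(2) unfolding perm_equiv_def by blast
  show ?thesis
    by (rule perm_equivI[OF permutes_compose[OF 2(1) 1(1)] permutes_compose[OF 2(2) 1(2)]])
      (simp add: B C)
qed

text \<open>The right factor has the \<open>1\<close> of column \<open>j\<close> in row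
  \<open>inv \<tau> j\<close>, so columns are reindexed by the inverse.\<close>

lemma permutation_matrix_mult_nth:
  fixes A :: "real ^ 'n ^ 'n"
  assumes "\<tau> permutes UNIV"
  shows "((\<chi> i j. if j = \<sigma> i then 1 else 0) ** A ** (\<chi> i j. if j = \<tau> i then 1 else 0)) $ i $ j
    = A $ \<sigma> i $ inv \<tau> j"
proof -
  have "j = \<tau> k \<longleftrightarrow> k = inv \<tau> j" for k
    using permutes_inverses[OF assms] by metis
  then show ?thesis
    by (simp add: matrix_matrix_mult_def if_distrib if_distribR sum.delta cong: if_cong)
qed

lemma perm_equiv_iff_matrix:
  fixes A B :: "real ^ 'n ^ 'n"
  shows "perm_equiv A B \<longleftrightarrow>
    (\<exists>P Q. permutation_matrix P \<and> permutation_matrix Q \<and> P ** A ** Q = B)"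
proof
  assume "perm_equiv A B"
  then obtain \<sigma> \<tau> where \<sigma>: "\<sigma> permutes UNIV" and \<tau>: "\<tau> permutes UNIV"
    and B: "B = (\<chi> i j. A $ \<sigma> i $ \<tau> j)"
    unfolding perm_equiv_def by blast
  define P Q :: "real ^ 'n ^ 'n" where "P = (\<chi> i j. if j = \<sigma> i then 1 else 0)"
    and "Q = (\<chi> i j. if j = inv \<tau> i then 1 else 0)"
  have "P ** A ** Q = B"
    unfolding P_def Q_def vec_eq_iff B
    by (simp add: permutation_matrix_mult_nth[OF permutes_inv[OF \<tau>]] permutes_inv_inv[OF \<tau>])
  moreover have "permutation_matrix P" "permutation_matrix Q"
    unfolding permutation_matrix_def P_def Q_def using \<sigma> permutes_inv[OF \<tau>] by blast+
  ultimately show "\<exists>P Q. permutation_matrix P \<and> permutation_matrix Q \<and> P ** A ** Q = B"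
    by blast
next
  assume "\<exists>P Q. permutation_matrix P \<and> permutation_matrix Q \<and> P ** A ** Q = B"
  then obtain \<sigma> \<tau> where \<sigma>: "\<sigma> permutes UNIV" and \<tau>: "\<tau> permutes UNIV" and
    B: "(\<chi> i j. if j = \<sigma> i then 1 else 0) ** A ** (\<chi> i j. if j = \<tau> i then 1 else 0) = B"
    unfolding permutation_matrix_def by blast
  show "perm_equiv A B"
    by (rule perm_equivI[OF \<sigma> permutes_inv[OF \<tau>]])
      (simp add: B[symmetric] permutation_matrix_mult_nth[OF \<tau>])
qed

lemma perm_equiv_frobenius_sq:
  assumes "perm_equiv A B"
  shows "frobenius_sq B = frobenius_sq A"
proof -
  obtain \<sigma> \<tau> where \<sigma>: "\<sigma> permutes UNIV" and \<tau>: "\<tau> permutes UNIV" and B: "B = (\<chi> i j. A $ \<sigma> i $ \<tau> j)"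
    using assms unfolding perm_equiv_def by blast
  have "(\<Sum>j\<in>UNIV. (A $ \<sigma> i $ \<tau> j)\<^sup>2) = (\<Sum>j\<in>UNIV. (A $ \<sigma> i $ j)\<^sup>2)" for i
    using sum.permute[OF \<tau>, of "\<lambda>j. (A $ \<sigma> i $ j)\<^sup>2"] by (simp add: o_def)
  then show ?thesis
    using sum.permute[OF \<sigma>, of "\<lambda>i. \<Sum>j\<in>UNIV. (A $ i $ j)\<^sup>2"]
    by (simp add: frobenius_sq_def B o_def)
qed

lemma perm_equiv_maxtr:
  fixes A B :: "real ^ 'n ^ 'n"
  assumes "perm_equiv A B"
  shows "maxtr B = maxtr A"
proof -
  \<comment> \<open>One inclusion between these sets of traces suffices, since the equivalence is
    symmetric.\<close>
  define D :: "real ^ 'n ^ 'n \<Rightarrow> real set"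
    where "D M = (\<lambda>\<rho>. \<Sum>i\<in>UNIV. M $ i $ \<rho> i) ` {\<rho>. \<rho> permutes UNIV}" for M
  have sub: "D N \<subseteq> D M" if MN: "perm_equiv M N" for M N :: "real ^ 'n ^ 'n"
  proof -
    obtain \<sigma> \<tau> where \<sigma>: "\<sigma> permutes UNIV" and \<tau>: "\<tau> permutes UNIV" and N: "N = (\<chi> i j. M $ \<sigma> i $ \<tau> j)"
      using MN unfolding perm_equiv_def by blast
    have "(\<Sum>i\<in>UNIV. N $ i $ \<rho> i) \<in> D M" if \<rho>: "\<rho> permutes UNIV" for \<rho>
    proof -
      \<comment> \<open>Reindexing the rows by \<open>inv \<sigma>\<close> turns a trace of
        \<open>N\<close> into a trace of \<open>M\<close>.\<close>
      have "(\<Sum>i\<in>UNIV. N $ i $ \<rho> i) = (\<Sum>i\<in>UNIV. M $ i $ (\<tau> \<circ> (\<rho> \<circ> inv \<sigma>)) i)"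
        using sum.permute[OF \<sigma>, of "\<lambda>i. M $ i $ \<tau> (\<rho> (inv \<sigma> i))"]
        by (simp add: N o_def permutes_inverses[OF \<sigma>])
      moreover have "\<tau> \<circ> (\<rho> \<circ> inv \<sigma>) permutes UNIV"
        by (intro permutes_compose permutes_inv \<sigma> \<tau> \<rho>)
      ultimately show ?thesis
        unfolding D_def by blast
    qed
    then show ?thesis
      by (auto simp: D_def)
  qed
  have "D B = D A"
    using sub[OF assms] sub[OF perm_equiv_sym[OF assms]] by blast
  then show ?thesis
    by (simp add: maxtr_def D_def)
qed

section \<open>Explicit Birkhoff decomposition for size 3 and its traces\<close>

text \<open>The permutations of \<open>\<int>/3\<close> are the maps \<open>i \<mapsto> i + c\<close> and \<open>i \<mapsto> c - i\<close>; in
  the next definition they have weights \<open>x c\<close> and \<open>y c\<close>.\<close>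

definition birkhoff_3 :: "(3 \<Rightarrow> real) \<Rightarrow> (3 \<Rightarrow> real) \<Rightarrow> real ^ 3 ^ 3" where
  "birkhoff_3 x y = (\<chi> i j. x (j - i) + y (i + j))"

text \<open>Adding a constant to \<open>x\<close> and subtracting it from \<open>y\<close> keeps the
  matrix. This freedom is spent on \<open>x m = 0\<close> for some \<open>m\<close>: then
  \<open>x\<close> is nonnegative by minimality, and each \<open>y d\<close> is an entry of
  \<open>A\<close>.\<close>

lemma doubly_stochastic_birkhoff_3:
  assumes "doubly_stochastic A"
  obtains x y where "A = birkhoff_3 x y" "\<And>c. x c \<ge> 0" "\<And>c. y c \<ge> 0" "sum x UNIV + sum y UNIV = 1"
proof -
  have nn: "A $ i $ j \<ge> 0" for i j
    using assms by (simp add: doubly_stochastic_def)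
  have row: "\<forall>i. A $ i $ 0 + A $ i $ 1 + A $ i $ 2 = 1"
    and col: "\<forall>j. A $ 0 $ j + A $ 1 $ j + A $ 2 $ j = 1"
    using assms by (simp_all add: doubly_stochastic_def Z3_sum)
  \<comment> \<open>The cell on both \<open>j - i = c\<close> and \<open>i + j = d\<close> is \<open>(c - d, - c - d)\<close>. The minimum over
    the cells with \<open>d = 0\<close> is moved from \<open>x\<close> to \<open>y\<close>.\<close>
  obtain m where m: "\<And>c. A $ m $ (- m) \<le> A $ c $ (- c)"
    using ex_min_if_finite[of "range (\<lambda>c. A $ c $ (- c))"] by (force simp: not_less)
  define x where "x c = A $ c $ (- c) - A $ m $ (- m)" for c
  define y where "y d = A $ (m - d) $ (- m - d)" for d
  \<comment> \<open>For each value of \<open>m\<close>, these nine identities are linear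
    consequences of the row and column sums.\<close>
  have eq: "\<forall>i j. A $ i $ j = x (j - i) + y (i + j)"
    using Z3_cases[of m]
  proof (elim disjE)
    assume "m = 0"
    with row col show ?thesis
      unfolding x_def y_def Z3_all by (simp add: Z3_simps)
  next
    assume "m = 1"
    with row col show ?thesis
      unfolding x_def y_def Z3_all by (simp add: Z3_simps)
  next
    assume "m = 2"
    with row col show ?thesis
      unfolding x_def y_def Z3_all by (simp add: Z3_simps)
  qed
  show ?thesis
  proof (rule that)
    show "A = birkhoff_3 x y"
      using eq by (simp add: birkhoff_3_def vec_eq_iff)
    show "x c \<ge> 0" "y c \<ge> 0" for c
      using m nn by (simp_all add: x_def y_def)
    \<comment> \<open>Along row \<open>0\<close> both \<open>j - i\<close> and \<open>i + j\<close>
      take each residue once, so the row sum is the total weight.\<close>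
    show "sum x UNIV + sum y UNIV = 1"
      using row[rule_format, of 0] eq by (simp add: Z3_sum)
  qed
qed

text \<open>Along a rotation \<open>j - i\<close> is constant, while
  \<open>i + j = 2 * i + c\<close> takes each residue once because 2 is invertible mod 3. Along a
  reflection the roles are exchanged.\<close>

lemma maxtr_birkhoff_3:
  "maxtr (birkhoff_3 x y) =
    Max (range (\<lambda>c. 3 * x c + sum y UNIV) \<union> range (\<lambda>c. 3 * y c + sum x UNIV))"
proof -
  have "{\<sigma>. \<sigma> permutes (UNIV :: 3 set)} = range (\<lambda>c i. i + c) \<union> range (\<lambda>c i. c - i)"
    using Z3_permutes permutes_add permutes_minus by fastforce
  moreover have "(\<Sum>i\<in>UNIV. birkhoff_3 x y $ i $ (i + c)) = 3 * x c + sum y UNIV" for c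
    using Z3_cases[of c] by (auto simp: birkhoff_3_def Z3_sum Z3_simps)
  moreover have "(\<Sum>i\<in>UNIV. birkhoff_3 x y $ i $ (c - i)) = 3 * y c + sum x UNIV" for c
    using Z3_cases[of c] by (auto simp: birkhoff_3_def Z3_sum Z3_simps)
  ultimately show ?thesis
    by (simp add: maxtr_def image_Un image_image)
qed

lemma frobenius_sq_birkhoff_3:
  "frobenius_sq (birkhoff_3 x y) =
    (\<Sum>c\<in>UNIV. x c * (3 * x c + sum y UNIV)) + (\<Sum>c\<in>UNIV. y c * (3 * y c + sum x UNIV))"
  by (simp add: frobenius_sq_def birkhoff_3_def Z3_sum Z3_simps power2_eq_square algebra_simps)

lemma birkhoff_3_equality:
  assumes nn: "\<And>c. x c \<ge> 0" "\<And>c. y c \<ge> 0" and one: "sum x UNIV + sum y UNIV = 1"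
    and eq: "frobenius_sq (birkhoff_3 x y) = maxtr (birkhoff_3 x y)"
  obtains M where "\<And>c. x c \<noteq> 0 \<Longrightarrow> 3 * x c + sum y UNIV = M" "\<And>c. y c \<noteq> 0 \<Longrightarrow> 3 * y c + sum x UNIV = M"
proof -
  define M where "M = maxtr (birkhoff_3 x y)"
  have le: "3 * x c + sum y UNIV \<le> M" "3 * y c + sum x UNIV \<le> M" for c
    unfolding M_def maxtr_birkhoff_3 by (auto intro!: Max_ge)
  \<comment> \<open>The weighted gaps between \<open>M\<close> and the individual traces are
    nonnegative, and they add up to 0 by the assumed equality; so each of them vanishes.\<close>
  have "(\<Sum>c\<in>UNIV. x c * (M - (3 * x c + sum y UNIV))) + (\<Sum>c\<in>UNIV. y c * (M - (3 * y c + sum x UNIV)))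
    = (sum x UNIV + sum y UNIV) * M - frobenius_sq (birkhoff_3 x y)"
    unfolding frobenius_sq_birkhoff_3 by (simp add: right_diff_distrib sum_subtractf sum_distrib_right distrib_right)
  also have "\<dots> = 0"
    using one eq by (simp add: M_def)
  finally have "(\<Sum>c\<in>UNIV. x c * (M - (3 * x c + sum y UNIV))) = 0 \<and> (\<Sum>c\<in>UNIV. y c * (M - (3 * y c + sum x UNIV))) = 0"
    using nn le by (subst (asm) add_nonneg_eq_0_iff) (auto intro!: sum_nonneg mult_nonneg_nonneg)
  then have "\<forall>c. x c * (M - (3 * x c + sum y UNIV)) = 0 \<and> y c * (M - (3 * y c + sum x UNIV)) = 0"
    using nn le by (simp add: sum_nonneg_eq_0_iff)
  then show ?thesis
    using that[of M] by force
qed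

section \<open>Normal forms of the weights under equivalence\<close>

lemma perm_equiv_birkhoff_3_shift:
  "perm_equiv (birkhoff_3 x y) (birkhoff_3 (\<lambda>c. x (c + s)) (\<lambda>c. y (c + t)))"
proof (rule perm_equivI[OF permutes_add permutes_add])
  \<comment> \<open>The row shift \<open>a\<close> and column shift \<open>b\<close> must satisfy
    \<open>b - a = s\<close> and \<open>a + b = t\<close>; since 2 is its own inverse mod 3, this
    gives \<open>a = s + 2 * t\<close> and \<open>b = 2 * (s + t)\<close>.\<close>
  have "j + 2 * (s + t) - (i + (s + 2 * t)) = j - i + s"
    and "i + (s + 2 * t) + (j + 2 * (s + t)) = i + j + t + 3 * s + 3 * t" for i j
    by (simp_all add: algebra_simps)
  moreover have "3 * s = 0" "3 * t = 0"
    by (simp_all add: Z3_simps)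
  ultimately have "j + 2 * (s + t) - (i + (s + 2 * t)) = j - i + s"
    and "i + (s + 2 * t) + (j + 2 * (s + t)) = i + j + t" for i j
    by simp_all
  then show "birkhoff_3 (\<lambda>c. x (c + s)) (\<lambda>c. y (c + t)) $ i $ j
      = birkhoff_3 x y $ (i + (s + 2 * t)) $ (j + 2 * (s + t))" for i j
    by (simp only: birkhoff_3_def vec_lambda_beta)
qed

text \<open>Negating the row index exchanges \<open>j - i\<close> with \<open>i + j\<close>.\<close>

lemma perm_equiv_birkhoff_3_swap: "perm_equiv (birkhoff_3 x y) (birkhoff_3 y x)"
  by (rule perm_equivI[OF permutes_minus[of 0] permutes_id]) (simp add: birkhoff_3_def algebra_simps)

definition weight_3 :: "real \<Rightarrow> 3 set \<Rightarrow> 3 \<Rightarrow> real" where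
  "weight_3 u S c = (if c \<in> S then u else 0)"

lemma weight_3_empty: "weight_3 u {} = (\<lambda>c. 0)"
  by (simp add: weight_3_def fun_eq_iff)

text \<open>Up to rotation, a subset of the residues mod 3 is determined by its size.\<close>

lemma shift_to_weight_3:
  assumes "\<And>c d. x c \<noteq> 0 \<Longrightarrow> x d \<noteq> 0 \<Longrightarrow> x c = x d"
  obtains s u S where "(\<lambda>c. x (c + s)) = weight_3 u S" "u \<noteq> 0" "S \<in> {{}, {0}, {1, 2}, UNIV}"
proof (cases "\<exists>c. x c \<noteq> 0")
  case True
  then obtain a where a: "x a \<noteq> 0" ..
  then have val: "x c = 0 \<or> x c = x a" for c
    using assms by blast
  have "\<exists>s. \<exists>S\<in>{{}, {0}, {1, 2}, UNIV}. \<forall>c. x (c + s) = weight_3 (x a) S c"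
    using val[of 0] val[of 1] val[of 2] unfolding Z3_ex Z3_all
    by (auto simp: weight_3_def Z3_simps)
  then show ?thesis
    using a that by blast
next
  case False
  \<comment> \<open>With empty support the value is arbitrary; \<open>1\<close> only meets
    \<open>u \<noteq> 0\<close>.\<close>
  then have "(\<lambda>c. x (c + 0)) = weight_3 1 {}"
    by (simp add: weight_3_def fun_eq_iff)
  then show ?thesis
    by (rule that) auto
qed

lemmas target_defs = mat_J3_def mat_I1J2_def mat_S_def mat_T_def mat_R_def mat_def

text \<open>List positions 1, 2, 3 are the residues 1, 2, 0, so the last row and column have index
  \<open>0\<close>. This determines the supports.\<close>

lemma target_birkhoff_3:
  "mat 1 = birkhoff_3 (weight_3 1 {0}) (\<lambda>c. 0)"
  "mat_J3 = birkhoff_3 (weight_3 (1/3) UNIV) (\<lambda>c. 0)"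
  "mat_I1J2 = birkhoff_3 (weight_3 (1/2) {0}) (weight_3 (1/2) {2})"
  "mat_S = birkhoff_3 (weight_3 (1/4) {1, 2}) (weight_3 (1/4) {0, 1})"
  "mat_T = birkhoff_3 (weight_3 (1/2) {1, 2}) (\<lambda>c. 0)"
  "mat_R = birkhoff_3 (weight_3 (1/5) {0}) (weight_3 (2/5) {1, 2})"
  by (simp_all add: target_defs birkhoff_3_def weight_3_def vec_eq_iff Z3_all Z3_simps vector_3_nth_0)

lemma target_equality:
  assumes "B \<in> {mat 1, mat_J3, mat_I1J2, mat_S, mat_T, mat_R}"
  shows "frobenius_sq B = maxtr B"
  using assms
  by (elim insertE emptyE; simp add: target_birkhoff_3 frobenius_sq_birkhoff_3 maxtr_birkhoff_3
      Z3_sum Z3_range weight_3_def)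

text \<open>If both supports are nonempty, the trace equations give
  \<open>(3 - card S) * u = (3 - card T) * v\<close>. Together with total weight 1 this fixes
  \<open>u\<close> and \<open>v\<close>, unless both supports are \<open>UNIV\<close>.\<close>

lemma weight_3_target:
  fixes u v M :: real
  assumes S: "S \<in> {{}, {0}, {1, 2}, UNIV}" and T: "T \<in> {{}, {0}, {1, 2}, UNIV}" and le: "card T \<le> card S"
    and u: "u \<noteq> 0" and v: "v \<noteq> 0" and one: "card S * u + card T * v = 1"
    and xM: "S \<noteq> {} \<Longrightarrow> 3 * u + card T * v = M" and yM: "T \<noteq> {} \<Longrightarrow> 3 * v + card S * u = M"
  shows "\<exists>B\<in>{mat 1, mat_J3, mat_I1J2, mat_S, mat_T, mat_R}.
    perm_equiv (birkhoff_3 (weight_3 u S) (weight_3 v T)) B"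
proof -
  have card1: "card {0 :: 3} = 1" and card2: "card {1, 2 :: 3} = 2" "card (UNIV :: 3 set) = 3"
    by simp_all
  have "T = {}" if "S = {}"
    using that le by simp
  then have S_ne: "S \<noteq> {}"
    using one by auto
  have S_UNIV: "T = UNIV" if "S = UNIV" "T \<noteq> {}"
  proof -
    have "3 * v + 3 * u = M"
      using yM that by (simp add: card2)
    with xM[OF S_ne] have "card T * v = 3 * v"
      by linarith
    then have "card T = 3"
      using v by simp
    then show ?thesis
      by (metis card2(2) card_subset_eq finite subset_UNIV)
  qed
  have T_le: "card T \<le> 1 \<Longrightarrow> T = {} \<or> T = {0}" "card T \<le> 2 \<Longrightarrow> T = {} \<or> T = {0} \<or> T = {1, 2}"
    using T card2 by auto
  consider "S = {0}" "T = {}" | "S = {1, 2}" "T = {}" | "S = UNIV" "T = {}"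
    | "S = {0}" "T = {0}" | "S = {1, 2}" "T = {0}" | "S = {1, 2}" "T = {1, 2}"
    | "S = UNIV" "T = UNIV"
    using S_ne S_UNIV T_le S T le by (metis card1 card2(1) empty_iff insert_iff)
  then show ?thesis
  proof cases
    case 1
    then have uv: "u = 1"
      using one by simp
    have "birkhoff_3 (weight_3 u S) (weight_3 v T) = mat 1"
      using 1 by (simp add: uv target_birkhoff_3 weight_3_empty)
    then show ?thesis
      using perm_equiv_refl by auto
  next
    case 2
    then have uv: "u = 1/2"
      using one by (simp add: card2)
    have "birkhoff_3 (weight_3 u S) (weight_3 v T) = mat_T"
      using 2 by (simp add: uv target_birkhoff_3 weight_3_empty)
    then show ?thesis
      using perm_equiv_refl by auto
  next
    case 3
    then have uv: "u = 1/3"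
      using one by (simp add: card2)
    have "birkhoff_3 (weight_3 u S) (weight_3 v T) = mat_J3"
      using 3 by (simp add: uv target_birkhoff_3 weight_3_empty)
    then show ?thesis
      using perm_equiv_refl by auto
  next
    case 4
    then have uv: "u = 1/2" "v = 1/2"
      using one xM yM by simp_all
    \<comment> \<open>The two parities rotate independently, so only the odd support has to be moved
      to the one in \<open>mat_I1J2\<close>.\<close>
    have shift: "(\<lambda>c. weight_3 (1/2) {0} (c + 1)) = weight_3 (1/2) {2}"
      unfolding weight_3_def fun_eq_iff Z3_all by (simp add: Z3_simps)
    have "perm_equiv (birkhoff_3 (weight_3 u S) (weight_3 v T)) mat_I1J2"
      using perm_equiv_birkhoff_3_shift[of "weight_3 u S" "weight_3 v T" 0 1] 4
      by (simp add: uv shift target_birkhoff_3)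
    then show ?thesis
      by blast
  next
    case 5
    then have uv: "u = 2/5" "v = 1/5"
      using one xM yM by (simp_all add: card2)
    \<comment> \<open>In the decomposition of \<open>mat_R\<close> the one-element support comes
      first, hence the swap.\<close>
    have "perm_equiv (birkhoff_3 (weight_3 u S) (weight_3 v T)) mat_R"
      using perm_equiv_birkhoff_3_swap[of "weight_3 u S" "weight_3 v T"] 5
      by (simp add: uv target_birkhoff_3)
    then show ?thesis
      by blast
  next
    case 6
    then have uv: "u = 1/4" "v = 1/4"
      using one xM yM by (simp_all add: card2)
    have shift: "(\<lambda>c. weight_3 (1/4) {1, 2} (c + 1)) = weight_3 (1/4) {0, 1}"
      unfolding weight_3_def fun_eq_iff Z3_all by (simp add: Z3_simps)
    have "perm_equiv (birkhoff_3 (weight_3 u S) (weight_3 v T)) mat_S"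
      using perm_equiv_birkhoff_3_shift[of "weight_3 u S" "weight_3 v T" 0 1] 6
      by (simp add: uv shift target_birkhoff_3)
    then show ?thesis
      by blast
  next
    case 7
    \<comment> \<open>Here only \<open>u + v = 1/3\<close> is determined, but every entry equals
      \<open>u + v\<close>.\<close>
    then have "birkhoff_3 (weight_3 u S) (weight_3 v T) = mat_J3"
      using one by (simp add: card2 target_birkhoff_3 birkhoff_3_def weight_3_def vec_eq_iff)
    then show ?thesis
      using perm_equiv_refl by auto
  qed
qed

section \<open>Reduction of the theorem to the normal forms\<close>

lemma sum_weight_3: "sum (weight_3 u S) UNIV = real (card S) * u"
  by (simp add: weight_3_def[abs_def] sum.If_cases)

lemma sum_shift: "(\<Sum>c\<in>UNIV. f (c + s)) = sum f (UNIV :: 'a::{finite,group_add} set)"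
  using sum.permute[OF permutes_add[of s], of f] by (simp add: o_def)

theorem theorem4p1:
  fixes A :: "real ^ 3 ^ 3"
  assumes "doubly_stochastic A"
  shows "frobenius_sq A = maxtr A \<longleftrightarrow>
    (\<exists>P Q :: real ^ 3 ^ 3. permutation_matrix P \<and> permutation_matrix Q \<and>
       P ** A ** Q \<in> {mat 1, mat_J3, mat_I1J2, mat_S, mat_T, mat_R})"
proof -
  let ?L = "{mat 1, mat_J3, mat_I1J2, mat_S, mat_T, mat_R}"
  have "frobenius_sq A = maxtr A \<longleftrightarrow> (\<exists>B\<in>?L. perm_equiv A B)"
  proof
    assume "\<exists>B\<in>?L. perm_equiv A B"
    then obtain B where B: "B \<in> ?L" and equiv: "perm_equiv A B"
      by blast
    show "frobenius_sq A = maxtr A"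
      using target_equality[OF B] perm_equiv_frobenius_sq[OF equiv] perm_equiv_maxtr[OF equiv]
      by simp
  next
    assume eq: "frobenius_sq A = maxtr A"
    obtain x y where A: "A = birkhoff_3 x y" and nn: "\<And>c. x c \<ge> 0" "\<And>c. y c \<ge> 0"
      and one: "sum x UNIV + sum y UNIV = 1"
      using doubly_stochastic_birkhoff_3[OF assms] by metis
    obtain M where xM: "\<And>c. x c \<noteq> 0 \<Longrightarrow> 3 * x c + sum y UNIV = M"
      and yM: "\<And>c. y c \<noteq> 0 \<Longrightarrow> 3 * y c + sum x UNIV = M"
      using birkhoff_3_equality[OF nn one] eq A by metis
    have "x c = x d" if "x c \<noteq> 0" "x d \<noteq> 0" for c d
      using xM[OF that(1)] xM[OF that(2)] by simp
    then obtain s u S where xs: "(\<lambda>c. x (c + s)) = weight_3 u S" and u: "u \<noteq> 0"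
      and S: "S \<in> {{}, {0}, {1, 2}, UNIV}"
      using shift_to_weight_3 by metis
    have "y c = y d" if "y c \<noteq> 0" "y d \<noteq> 0" for c d
      using yM[OF that(1)] yM[OF that(2)] by simp
    then obtain t v T where yt: "(\<lambda>c. y (c + t)) = weight_3 v T" and v: "v \<noteq> 0"
      and T: "T \<in> {{}, {0}, {1, 2}, UNIV}"
      using shift_to_weight_3 by metis
    have sums: "sum x UNIV = card S * u" "sum y UNIV = card T * v"
      using sum_shift[of x s] sum_shift[of y t] unfolding xs yt sum_weight_3 by simp_all
    \<comment> \<open>Any point of the support of the shifted weights gives a nonzero weight of
      \<open>x\<close>, equal to \<open>u\<close>, whose trace is \<open>M\<close>.\<close>
    have xM': "3 * u + card T * v = M" if ne: "S \<noteq> {}"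
    proof -
      obtain c where "c \<in> S"
        using ne by blast
      then have "x (c + s) = u"
        using fun_cong[OF xs, of c] by (simp add: weight_3_def)
      then show ?thesis
        using xM[of "c + s"] u sums by simp
    qed
    have yM': "3 * v + card S * u = M" if ne: "T \<noteq> {}"
    proof -
      obtain c where "c \<in> T"
        using ne by blast
      then have "y (c + t) = v"
        using fun_cong[OF yt, of c] by (simp add: weight_3_def)
      then show ?thesis
        using yM[of "c + t"] v sums by simp
    qed
    have one': "card S * u + card T * v = 1"
      using one sums by simp
    have shift: "perm_equiv A (birkhoff_3 (weight_3 u S) (weight_3 v T))"
      using perm_equiv_birkhoff_3_shift[of x y s t] by (simp add: A xs yt)
    \<comment> \<open>The classification expects the larger support first; otherwise the parities
      are swapped.\<close>
    consider "card T \<le> card S" | "card S \<le> card T"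
      by linarith
    then show "\<exists>B\<in>?L. perm_equiv A B"
    proof cases
      case 1
      then show ?thesis
        using weight_3_target[OF S T _ u v one' xM' yM'] perm_equiv_trans[OF shift] by blast
    next
      case 2
      have "card T * v + card S * u = 1"
        using one' by simp
      then show ?thesis
        using weight_3_target[OF T S 2 v u _ yM' xM']
          perm_equiv_trans[OF perm_equiv_trans[OF shift perm_equiv_birkhoff_3_swap]] by blast
    qed
  qed
  also have "\<dots> \<longleftrightarrow> (\<exists>P Q :: real ^ 3 ^ 3. permutation_matrix P \<and> permutation_matrix Q \<and> P ** A ** Q \<in> ?L)"
    unfolding perm_equiv_iff_matrix by blast
  finally show ?thesis .
qed

end
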